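(* Let $d\ge 1$ be an integer, let $C$ be a finite set with $|C|=k>1$, and let $\varphi:\mathbb{R}^d\to C$ be a coloring of $\mathbb{R}^d$. Then $\varphi$ is an ordered Szlam coloring of $\mathbb{R}^d$ (in the sense defined in the context, i.e. up to identifying the colors $c_1,\dots,c_k$ of some ordering of $C$ with the indices $1,\dots,k$) if and only if there is an ordering $c_1,\dots,c_k$ of $C$ with respect to which $\varphi$ is dominant. Further, for every ordering $c_1,\dots,c_k$ of $C$ with respect to which $\varphi$ is dominant, there exist a partition $R,B$ of $\mathbb{R}^d$ and a set $F\subseteq\mathbb{R}^d$ with an ordering $f_1,\dots,f_k$ of $F$, such that no translate of $F$ is contained in $R$, and such that for every $j\in\{1,\dots,k\}$ and every $v\in\mathbb{R}^d$: $$\varphi(v)=c_j \iff \big(v+f_j\in B \text{ and } v+f_i\in R \text{ for all } i<j\big).$$ That is, $\varphi$ is the ordered Szlam coloring associated with $R,B,F$ and the ordering $f_1,\dots,f_k$ of $F$, with color $c_j$ corresponding to index $j$.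
   Context: Ordered Szlam coloring: Let $R,B$ be a partition of $\mathbb{R}^d$ (so $R=\mathbb{R}^d\setminus B$) and let $F\subseteq\mathbb{R}^d$ be a finite nonempty set such that no translate $v+F$ ($v\in\mathbb{R}^d$) is contained in $R$. Given an ordering $f_1,\dots,f_k$ of $F$, the ordered Szlam coloring of $\mathbb{R}^d$ associated with $R,B,F$ and this ordering is the function $\psi:\mathbb{R}^d\to\{1,\dots,k\}$ such that for each $v\in\mathbb{R}^d$, $\psi(v)$ is the smallest index $i$ with $v+f_i\in B$. A coloring $\varphi:\mathbb{R}^d\to C$ with $|C|=k$ is called an ordered Szlam coloring if, for some such $R,B,F$, ordering $f_1,\dots,f_k$ of $F$, and some ordering $c_1,\dots,c_k$ of $C$, one has $\varphi(v)=c_i\iff\psi(v)=i$ for all $v$. Dominance: For an ordering $c_1,\dots,c_k$ of $C$, let $A_i=\varphi^{-1}(\{c_i\})$ for $i=1,\dots,k$. The coloring $\varphi$ is dominant with respect to the ordering $c_1,\dots,c_k$ if there exist distinct vectors $t_2,\dots,t_k\in\mathbb{R}^d$ such that (i) $A_i+t_i\subseteq A_1$ for all $i\in\{2,\dots,k\}$, and (ii) $(A_j+t_i)\cap A_1=\emptyset$ for all $1<i<j\le k$. Here $A+t=\{a+t: a\in A\}$.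
   Formalization: In the "Further" part, f_1,…,f_k always lists F, but the f_i are asserted to be distinct only when every color of C is used; with an unused color distinctness can fail (k=3, φ(0)=c_3, φ(v)=c_1 otherwise, which forces f_1=f_2). *)

theory Defs
  imports "HOL-Analysis.Analysis"
begin

text \<open>
  Either part of the partition may be empty (it is just a set and its complement).
\<close>

definition szlam_triple ::
  "(real ^ 'n) set \<Rightarrow> (real ^ 'n) set \<Rightarrow> (real ^ 'n) set \<Rightarrow> bool" where
  "szlam_triple R B F \<longleftrightarrow>
     R \<union> B = UNIV \<and> R \<inter> B = {} \<and> finite F \<and> F \<noteq> {} \<and>
     (\<forall>v. \<not> (\<lambda>x. v + x) ` F \<subseteq> R)"

text \<open>
  Orderings \<open>f\<^sub>1, \<dots>, f\<^sub>k\<close> are functions on \<^typ>\<open>nat\<close>, of which only the values on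
  \<open>{1..k}\<close> matter.
\<close>

definition szlam_index ::
  "(real ^ 'n) set \<Rightarrow> (nat \<Rightarrow> real ^ 'n) \<Rightarrow> nat \<Rightarrow> real ^ 'n \<Rightarrow> nat" where
  "szlam_index B f k v = (LEAST i. i \<in> {1..k} \<and> v + f i \<in> B)"

definition ordered_szlam_coloring :: "'c set \<Rightarrow> (real ^ 'n \<Rightarrow> 'c) \<Rightarrow> bool" where
  "ordered_szlam_coloring C \<phi> \<longleftrightarrow>
     (\<exists>R B F f c. szlam_triple R B F \<and>
        bij_betw f {1..card C} F \<and> bij_betw c {1..card C} C \<and>
        (\<forall>v. \<forall>i\<in>{1..card C}. \<phi> v = c i \<longleftrightarrow> szlam_index B f (card C) v = i))"

text \<open>
  \<open>t\<^sub>i = 0\<close> is allowed; since \<open>A\<^sub>i\<close> and \<open>A\<^sub>1\<close> are disjoint, it forces \<open>A\<^sub>i = {}\<close>,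
  i.e. the color \<open>c\<^sub>i\<close> is not used.
\<close>

definition dominant :: "(real ^ 'n \<Rightarrow> 'c) \<Rightarrow> (nat \<Rightarrow> 'c) \<Rightarrow> nat \<Rightarrow> bool" where
  "dominant \<phi> c k \<longleftrightarrow>
     (let A = (\<lambda>i. \<phi> -` {c i}) in
      \<exists>t :: nat \<Rightarrow> real ^ 'n. inj_on t {2..k} \<and>
        (\<forall>i\<in>{2..k}. (\<lambda>a. a + t i) ` A i \<subseteq> A 1) \<and>
        (\<forall>i j. 1 < i \<and> i < j \<and> j \<le> k \<longrightarrow> (\<lambda>a. a + t i) ` A j \<inter> A 1 = {}))"

end

theory Submission imports Defs begin

text \<open>
  If \<open>\<phi>\<close> is the ordered Szlam coloring of \<open>R, B\<close> and \<open>f\<^sub>1, \<dots>, f\<^sub>k\<close>, then \<open>A\<^sub>1 = B - f\<^sub>1\<close>, and the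
  vectors \<open>t\<^sub>i = f\<^sub>i - f\<^sub>1\<close> witness dominance. Conversely, vectors \<open>t\<^sub>i\<close> witnessing dominance give
  the Szlam data \<open>B = A\<^sub>1\<close>, \<open>f\<^sub>1 = 0\<close>, \<open>f\<^sub>i = t\<^sub>i\<close>. These \<open>f\<^sub>i\<close> are distinct unless some \<open>t\<^sub>m = 0\<close>, in
  which case the color \<open>c\<^sub>m\<close> is unused. Moving an unused color to the last position preserves
  dominance and leaves its vector unconstrained, so that it can be chosen away from \<open>0\<close> and from
  the other vectors.
\<close>

text \<open>Conditions (i) and (ii) of dominance, stated pointwise for a given \<open>t\<close>.
  Distinctness of the vectors is split off because it is the only delicate point of the converse
  direction.\<close>

definition dominating_shifts ::
  "(real ^ 'n \<Rightarrow> 'c) \<Rightarrow> (nat \<Rightarrow> 'c) \<Rightarrow> nat \<Rightarrow> (nat \<Rightarrow> real ^ 'n) \<Rightarrow> bool" where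
  "dominating_shifts \<phi> c k t \<longleftrightarrow>
     (\<forall>i\<in>{2..k}. \<forall>v. \<phi> v = c i \<longrightarrow> \<phi> (v + t i) = c 1) \<and>
     (\<forall>i j v. 1 < i \<and> i < j \<and> j \<le> k \<and> \<phi> v = c j \<longrightarrow> \<phi> (v + t i) \<noteq> c 1)"

lemma dominating_shifts_in:
  "dominating_shifts \<phi> c k t \<Longrightarrow> 2 \<le> i \<Longrightarrow> i \<le> k \<Longrightarrow> \<phi> v = c i \<Longrightarrow> \<phi> (v + t i) = c 1"
  by (simp add: dominating_shifts_def)

lemma dominating_shifts_notin:
  "dominating_shifts \<phi> c k t \<Longrightarrow> 1 < i \<Longrightarrow> i < j \<Longrightarrow> j \<le> k \<Longrightarrow> \<phi> v = c j \<Longrightarrow> \<phi> (v + t i) \<noteq> c 1"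
  unfolding dominating_shifts_def by blast

lemma dominant_iff_dominating_shifts:
  "dominant \<phi> c k \<longleftrightarrow> (\<exists>t. inj_on t {2..k} \<and> dominating_shifts \<phi> c k t)"
proof -
  have 1: "(\<lambda>a. a + s) ` (\<phi> -` {x}) \<subseteq> \<phi> -` {y} \<longleftrightarrow> (\<forall>v. \<phi> v = x \<longrightarrow> \<phi> (v + s) = y)" for s x y
    by auto
  have 2: "(\<lambda>a. a + s) ` (\<phi> -` {x}) \<inter> \<phi> -` {y} = {} \<longleftrightarrow> (\<forall>v. \<phi> v = x \<longrightarrow> \<phi> (v + s) \<noteq> y)" for s x y
    by auto
  show ?thesis
    unfolding dominant_def dominating_shifts_def Let_def 1 2 by meson
qed

text \<open>\<open>LEAST\<close> has an unspecified value when no index hits \<open>B\<close>; the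
  first assumption excludes this.\<close>

lemma szlam_index_eq_iff:
  assumes "\<exists>i\<in>{1..k}. v + f i \<in> B" and "j \<in> {1..k}"
  shows "szlam_index B f k v = j \<longleftrightarrow> v + f j \<in> B \<and> (\<forall>i\<in>{1..<j}. v + f i \<notin> B)"
proof
  let ?P = "\<lambda>i. i \<in> {1..k} \<and> v + f i \<in> B"
  assume "szlam_index B f k v = j"
  then have j: "j = (LEAST i. ?P i)"
    by (simp add: szlam_index_def)
  have "?P j"
    unfolding j by (rule LeastI_ex) (use assms(1) in blast)
  moreover have "\<not> ?P i" if "i < j" for i
    using that not_less_Least[of i ?P] unfolding j by blast
  ultimately show "v + f j \<in> B \<and> (\<forall>i\<in>{1..<j}. v + f i \<notin> B)"
    using assms(2) by auto
next
  assume *: "v + f j \<in> B \<and> (\<forall>i\<in>{1..<j}. v + f i \<notin> B)"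
  show "szlam_index B f k v = j"
    unfolding szlam_index_def
    by (rule Least_equality) (use * assms(2) in \<open>auto intro: leI\<close>)
qed

lemma szlam_triple_obtains_index:
  assumes "szlam_triple R B F" and "f ` {1..k} = F"
  shows "\<exists>i\<in>{1..k}. v + f i \<in> B"
proof -
  obtain x where "x \<in> F" "v + x \<notin> R"
    using assms(1) unfolding szlam_triple_def by blast
  then show ?thesis
    using assms unfolding szlam_triple_def by blast
qed

lemma dominant_if_ordered_szlam_coloring:
  assumes "ordered_szlam_coloring C \<phi>" and "card C \<ge> 1"
  shows "\<exists>c. bij_betw c {1..card C} C \<and> dominant \<phi> c (card C)"
proof -
  let ?k = "card C"
  obtain R B F f c where tri: "szlam_triple R B F" and f: "bij_betw f {1..?k} F"
    and c: "bij_betw c {1..?k} C"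
    and \<phi>: "\<And>v i. i \<in> {1..?k} \<Longrightarrow> \<phi> v = c i \<longleftrightarrow> szlam_index B f ?k v = i"
    using assms(1) unfolding ordered_szlam_coloring_def by blast
  have ex: "\<exists>i\<in>{1..?k}. v + f i \<in> B" for v
    by (rule szlam_triple_obtains_index[OF tri bij_betw_imp_surj_on[OF f]])
  have color: "\<phi> v = c j \<longleftrightarrow> v + f j \<in> B \<and> (\<forall>i\<in>{1..<j}. v + f i \<notin> B)" if "j \<in> {1..?k}" for v j
    using \<phi>[OF that] szlam_index_eq_iff[OF ex that] by simp
  have color1: "\<phi> v = c 1 \<longleftrightarrow> v + f 1 \<in> B" for v
    using color[of 1] assms(2) by simp
  define t where "t i = f i - f 1" for i
  have "inj_on t {2..?k}"
    using inj_onD[OF bij_betw_imp_inj_on[OF f]] by (intro inj_onI) (simp add: t_def)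
  \<comment> \<open>Since \<open>v + t i + f 1 = v + f i\<close>, the point \<open>v + t i\<close>
    has color \<open>c 1\<close> exactly when \<open>v + f i \<in> B\<close>. This holds if
    \<open>v\<close> has color \<open>c i\<close> and fails if \<open>v\<close> has a later
    color.\<close>
  moreover have "dominating_shifts \<phi> c ?k t"
    unfolding dominating_shifts_def color1 by (auto simp: color t_def)
  ultimately show ?thesis
    using c unfolding dominant_iff_dominating_shifts by blast
qed

lemma szlam_of_dominating_shifts:
  fixes \<phi> :: "real ^ 'n \<Rightarrow> 'c"
  assumes c: "bij_betw c {1..k} C" and range: "range \<phi> \<subseteq> C" and t: "dominating_shifts \<phi> c k t"
  defines "B \<equiv> \<phi> -` {c 1}" and "f \<equiv> t(1 := 0)"
  shows "szlam_triple (- B) B (f ` {1..k})"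
    and "\<forall>j\<in>{1..k}. \<forall>v. \<phi> v = c j \<longleftrightarrow> (v + f j \<in> B \<and> (\<forall>i\<in>{1..<j}. v + f i \<in> - B))"
proof -
  let ?first = "\<lambda>v j. v + f j \<in> B \<and> (\<forall>i\<in>{1..<j}. v + f i \<in> - B)"
  have first: "?first v j" if "\<phi> v = c j" "j \<in> {1..k}" for v j
  proof -
    \<comment> \<open>This covers the index \<open>1\<close> below \<open>j\<close>: as
      \<open>f 1 = 0\<close>, it has to be shown that \<open>v\<close> itself lies outside
      \<open>B\<close>.\<close>
    have "c j \<noteq> c 1" if "j \<noteq> 1"
      using inj_onD[OF bij_betw_imp_inj_on[OF c], of j 1] \<open>j \<in> {1..k}\<close> that by auto
    then show ?thesis
      using that dominating_shifts_in[OF t, of j v] dominating_shifts_notin[OF t, of _ j v]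
      by (auto simp: B_def f_def)
  qed
  have ex: "\<exists>j\<in>{1..k}. \<phi> v = c j" for v
    using range c unfolding bij_betw_def by blast
  show "\<forall>j\<in>{1..k}. \<forall>v. \<phi> v = c j \<longleftrightarrow> ?first v j"
  proof (intro ballI allI iffI)
    \<comment> \<open>The first index hitting \<open>B\<close> is unique, so this converse follows
      from \<open>first\<close> applied to the actual color \<open>c l\<close> of
      \<open>v\<close>.\<close>
    fix j v assume j: "j \<in> {1..k}" "?first v j"
    obtain l where l: "l \<in> {1..k}" "\<phi> v = c l"
      using ex by blast
    have "?first v l"
      using first l by blast
    then have "l = j"
      using j l(1) by (cases l j rule: linorder_cases) auto
    then show "\<phi> v = c j"
      using l by simp
  qed (use first in blast)
  have "\<not> (\<lambda>x. v + x) ` f ` {1..k} \<subseteq> - B" for v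
    using ex[of v] first[of v] by blast
  moreover have "{1..k} \<noteq> {}"
    using ex by blast
  ultimately show "szlam_triple (- B) B (f ` {1..k})"
    unfolding szlam_triple_def by blast
qed

lemma inj_on_fun_upd_1:
  fixes t :: "nat \<Rightarrow> 'a::zero"
  assumes "inj_on t {2..k}" and "\<And>i. i \<in> {2..k} \<Longrightarrow> t i \<noteq> 0"
  shows "inj_on (t(1 := 0)) {1..k}"
proof (rule inj_onI)
  fix i j assume *: "i \<in> {1..k}" "j \<in> {1..k}" "(t(1 := 0)) i = (t(1 := 0)) j"
  show "i = j"
    using * assms(2)[of i] assms(2)[of j] inj_onD[OF assms(1), of i j]
    by (cases "i = 1"; cases "j = 1") auto
qed

text \<open>With the shift \<open>0\<close>, condition (i) would give a point of color
  \<open>c m\<close> the color \<open>c 1\<close> as well, against injectivity of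
  \<open>c\<close>.\<close>

lemma dominating_shifts_zero_unused:
  assumes "bij_betw c {1..k} C" and "dominating_shifts \<phi> c k t" and "m \<in> {2..k}" and "t m = 0"
  shows "\<phi> v \<noteq> c m"
proof
  assume "\<phi> v = c m"
  then have "c m = c 1"
    using dominating_shifts_in[OF assms(2), of m v] assms(3,4) by simp
  then show False
    using inj_onD[OF bij_betw_imp_inj_on[OF assms(1)], of m 1] assms(3) by simp
qed

lemma dominating_shifts_nonzero:
  fixes \<phi> :: "real ^ 'n \<Rightarrow> 'c"
  assumes c: "bij_betw c {1..k} C" and inj: "inj_on t {2..k}" and t: "dominating_shifts \<phi> c k t"
  obtains c' t' where "bij_betw c' {1..k} C" "inj_on t' {2..k}" "dominating_shifts \<phi> c' k t'"
    "\<And>i. i \<in> {2..k} \<Longrightarrow> t' i \<noteq> 0"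
proof (cases "\<exists>m\<in>{2..k}. t m = 0")
  case False
  then show ?thesis
    using that c inj t by blast
next
  case True
  then obtain m where m: "m \<in> {2..k}" "t m = 0"
    by blast
  have unused: "\<phi> v \<noteq> c m" for v
    using dominating_shifts_zero_unused[OF c t m] .
  have "infinite (UNIV :: (real ^ 'n) set)"
    using finite_imp_bounded not_bounded_UNIV by blast
  \<comment> \<open>The replacement for the zero vector \<open>t m\<close>.\<close>
  then obtain s where s: "s \<notin> insert 0 (t ` {2..k})"
    by (metis ex_new_if_finite finite_atLeastAtMost finite_imageI finite_insert)
  define p where "p i = (if i < m then i else if i < k then Suc i else m)" for i
  define t' where "t' i = (if i = k then s else t (p i))" for i
  have p_inj: "inj_on p {1..k}"
    unfolding inj_on_def p_def using m(1) by auto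
  have "p ` {1..k} \<subseteq> {1..k}"
    unfolding p_def using m(1) by auto
  then have p: "bij_betw p {1..k} {1..k}"
    using p_inj by (simp add: bij_betw_def endo_inj_surj)
  have p1: "p 1 = 1"
    unfolding p_def using m(1) by auto
  have pk: "p k = m"
    unfolding p_def using m(1) by auto
  have p_range: "p i \<in> {2..k}" "p i \<noteq> m" if "2 \<le> i" "i < k" for i
    using that m(1) unfolding p_def by auto
  have p_mono: "p i < p j" if "i < j" "j < k" for i j
    using that unfolding p_def by auto
  have "bij_betw (c \<circ> p) {1..k} C"
    using bij_betw_trans[OF p c] .
  moreover have "inj_on t' {2..k}"
  proof (rule inj_onI)
    fix i j assume ij: "i \<in> {2..k}" "j \<in> {2..k}" "t' i = t' j"
    show "i = j"
    proof (cases "i = k \<or> j = k")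
      case True
      then show ?thesis
        using ij s p_range(1)[of i] p_range(1)[of j] unfolding t'_def
        by (auto split: if_splits)
    next
      case False
      then have "p i = p j"
        using ij p_range(1) inj_onD[OF inj, of "p i" "p j"] unfolding t'_def by auto
      then show ?thesis
        using ij inj_onD[OF p_inj, of i j] by simp
    qed
  qed
  moreover have "dominating_shifts \<phi> (c \<circ> p) k t'"
    unfolding dominating_shifts_def
  proof (intro conjI ballI allI impI)
    fix i v assume i: "i \<in> {2..k}" "\<phi> v = (c \<circ> p) i"
    then have "i \<noteq> k"
      using unused pk by auto
    then show "\<phi> (v + t' i) = (c \<circ> p) 1"
      using i p_range(1)[of i] dominating_shifts_in[OF t, of "p i" v] p1 by (simp add: t'_def)
  next
    fix i j v assume ij: "1 < i \<and> i < j \<and> j \<le> k \<and> \<phi> v = (c \<circ> p) j"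
    \<comment> \<open>Again \<open>j = k\<close> is vacuous. Otherwise \<open>i < j < k\<close>, so
      \<open>s\<close> does not occur and monotonicity of \<open>p\<close> reduces the claim to (ii)
      for \<open>t\<close>.\<close>
    then have "j \<noteq> k"
      using unused pk by auto
    then show "\<phi> (v + t' i) \<noteq> (c \<circ> p) 1"
      using ij p_range(1)[of i] p_range(1)[of j] p_mono[of i j]
        dominating_shifts_notin[OF t, of "p i" "p j" v] p1
      by (simp add: t'_def)
  qed
  \<comment> \<open>For \<open>i < k\<close>, injectivity of \<open>t\<close> makes \<open>m\<close>
    the only index with vector \<open>0\<close>, and \<open>p i \<noteq> m\<close>.\<close>
  moreover have "t' i \<noteq> 0" if "i \<in> {2..k}" for i
    using that s p_range[of i] m inj_onD[OF inj, of "p i" m] unfolding t'_def by auto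
  ultimately show ?thesis
    using that by blast
qed

text \<open>The ordering of the colors is existentially quantified in the conclusion, so
  \<open>c\<close> may be exchanged for an ordering \<open>c'\<close> with nonzero vectors, which
  makes \<open>f\<close> injective.\<close>

lemma ordered_szlam_coloring_if_dominant:
  fixes \<phi> :: "real ^ 'n \<Rightarrow> 'c"
  assumes c: "bij_betw c {1..card C} C" and "range \<phi> \<subseteq> C" and "dominant \<phi> c (card C)"
  shows "ordered_szlam_coloring C \<phi>"
proof -
  let ?k = "card C"
  obtain t where t: "inj_on t {2..?k}" "dominating_shifts \<phi> c ?k t"
    using assms(3) unfolding dominant_iff_dominating_shifts by blast
  obtain c' t' where c': "bij_betw c' {1..?k} C" and inj: "inj_on t' {2..?k}"
    and t': "dominating_shifts \<phi> c' ?k t'" and nz: "\<And>i. i \<in> {2..?k} \<Longrightarrow> t' i \<noteq> 0"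
    using dominating_shifts_nonzero[OF c t] by metis
  define B where "B = \<phi> -` {c' 1}"
  define f where "f = t'(1 := 0)"
  note S = szlam_of_dominating_shifts[OF c' assms(2) t', folded B_def f_def]
  have "bij_betw f {1..?k} (f ` {1..?k})"
    unfolding f_def by (intro inj_on_imp_bij_betw inj_on_fun_upd_1 inj nz)
  moreover have "\<phi> v = c' i \<longleftrightarrow> szlam_index B f ?k v = i" if "i \<in> {1..?k}" for v i
    using S(2) that szlam_index_eq_iff[OF szlam_triple_obtains_index[OF S(1) refl] that] by simp
  ultimately show ?thesis
    unfolding ordered_szlam_coloring_def using S(1) c' by blast
qed

theorem theorem3p1:
  fixes C :: "'c set" and k :: nat and \<phi> :: "real ^ 'n \<Rightarrow> 'c"
  assumes "finite C" and "card C = k" and "k > 1"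
    and "range \<phi> \<subseteq> C"
  shows "(ordered_szlam_coloring C \<phi> \<longleftrightarrow> (\<exists>c. bij_betw c {1..k} C \<and> dominant \<phi> c k)) \<and>
    (\<forall>c. bij_betw c {1..k} C \<and> dominant \<phi> c k \<longrightarrow>
      (\<exists>R B F f. szlam_triple R B F \<and> f ` {1..k} = F \<and>
         (range \<phi> = C \<longrightarrow> bij_betw f {1..k} F) \<and>
         (\<forall>j\<in>{1..k}. \<forall>v. \<phi> v = c j \<longleftrightarrow>
            (v + f j \<in> B \<and> (\<forall>i\<in>{1..<j}. v + f i \<in> R)))))"
proof (rule conjI)
  show "ordered_szlam_coloring C \<phi> \<longleftrightarrow> (\<exists>c. bij_betw c {1..k} C \<and> dominant \<phi> c k)"
    using dominant_if_ordered_szlam_coloring[of C \<phi>] ordered_szlam_coloring_if_dominant[of _ C \<phi>]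
      assms by auto
next
  show "\<forall>c. bij_betw c {1..k} C \<and> dominant \<phi> c k \<longrightarrow>
      (\<exists>R B F f. szlam_triple R B F \<and> f ` {1..k} = F \<and>
         (range \<phi> = C \<longrightarrow> bij_betw f {1..k} F) \<and>
         (\<forall>j\<in>{1..k}. \<forall>v. \<phi> v = c j \<longleftrightarrow>
            (v + f j \<in> B \<and> (\<forall>i\<in>{1..<j}. v + f i \<in> R))))"
  proof (intro allI impI)
    fix c assume "bij_betw c {1..k} C \<and> dominant \<phi> c k"
    then obtain t where c: "bij_betw c {1..k} C" and inj: "inj_on t {2..k}"
      and t: "dominating_shifts \<phi> c k t"
      unfolding dominant_iff_dominating_shifts by blast
    \<comment> \<open>Here the ordering \<open>c\<close> is prescribed and cannot be rearranged. If
      every color is used, no \<open>t i\<close> is \<open>0\<close>, so the value \<open>0\<close>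
      at index \<open>1\<close> is not repeated.\<close>
    have "bij_betw (t(1 := 0)) {1..k} (t(1 := 0) ` {1..k})" if "range \<phi> = C"
    proof (intro inj_on_imp_bij_betw inj_on_fun_upd_1 inj)
      fix i assume i: "i \<in> {2..k}"
      then have "c i \<in> range \<phi>"
        using c that by (auto simp: bij_betw_def)
      then show "t i \<noteq> 0"
        using dominating_shifts_zero_unused[OF c t i] by (metis rangeE)
    qed
    then show "\<exists>R B F f. szlam_triple R B F \<and> f ` {1..k} = F \<and>
         (range \<phi> = C \<longrightarrow> bij_betw f {1..k} F) \<and>
         (\<forall>j\<in>{1..k}. \<forall>v. \<phi> v = c j \<longleftrightarrow>
            (v + f j \<in> B \<and> (\<forall>i\<in>{1..<j}. v + f i \<in> R)))"
      using szlam_of_dominating_shifts[OF c assms(4) t] by blast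
  qed
qed

end
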